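(* Let $f,g\colon I\to I$ be piecewise monotone onto maps. If $f\circ g^{-1}=g^{-1}\circ f$, then $C_f\cap C_g=\emptyset$.
   Context: $I=[0,1]$; a map is a continuous function. A point $c\in(0,1)$ is a critical point of a map $f\colon I\to I$ if $f|_U$ is not one-to-one for every open interval $U\ni c$; $C_f$ denotes the set of critical points of $f$, and $f$ is piecewise monotone if $C_f$ is finite. The equality $f\circ g^{-1}=g^{-1}\circ f$ is an equality of set-valued functions: for every $x\in I$, $\{f(y): y\in I,\ g(y)=x\}=\{z\in I: g(z)=f(x)\}$. *)

theory Defs
  imports "HOL-Analysis.Analysis"
begin

text \<open>Maps of the unit interval are total functions on the reals of which only the values on
  \<open>{0..1}\<close> matter. Accordingly, the open intervals in the definition of a critical point range
  over the nonempty open subintervals of \<open>{0..1}\<close>.\<close>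

definition critical_points :: "(real \<Rightarrow> real) \<Rightarrow> real set" where
  "critical_points f =
     {c \<in> {0<..<1}. \<forall>a b. 0 \<le> a \<and> b \<le> 1 \<and> c \<in> {a<..<b} \<longrightarrow> \<not> inj_on f {a<..<b}}"

definition piecewise_monotone :: "(real \<Rightarrow> real) \<Rightarrow> bool" where
  "piecewise_monotone f \<longleftrightarrow> finite (critical_points f)"

definition interval_fibre :: "(real \<Rightarrow> real) \<Rightarrow> real \<Rightarrow> real set" where
  "interval_fibre g x = {y \<in> {0..1}. g y = x}"

text \<open>The equality of the set-valued functions \<open>f \<circ> g\<inverse>\<close> and \<open>g\<inverse> \<circ> f\<close>
  on the unit interval.\<close>

definition commutes_with_inverse :: "(real \<Rightarrow> real) \<Rightarrow> (real \<Rightarrow> real) \<Rightarrow> bool" where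
  "commutes_with_inverse f g \<longleftrightarrow>
     (\<forall>x \<in> {0..1}. f ` interval_fibre g x = interval_fibre g (f x))"

end

theory Submission
  imports Defs
begin

text \<open>Cut \<open>{0..1}\<close> at the finite set \<open>V\<close> of values of \<open>g\<close> at its critical points and endpoints. If
  \<open>t \<notin> V\<close> and \<open>f t = g c\<close> is such a value, then \<open>f\<close> has at \<open>t\<close> an extremum of the same kind as \<open>g\<close> at
  \<open>c\<close>; hence the image under \<open>f\<close> of a component of \<open>{0..1} - V\<close> does not cross \<open>V\<close>. As \<open>f\<close> is onto, it
  permutes these components. The number of \<open>g\<close>-preimages is constant on each of them and does not
  increase along \<open>f\<close>, so it is preserved, and \<open>f\<close> is injective on generic fibres of \<open>g\<close>. But at a
  common critical point \<open>c\<close> the map \<open>g\<close> folds points \<open>y < c < z\<close> together, and \<open>g (f y) = g (f z)\<close> with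
  \<open>f y\<close>, \<open>f z\<close> on the same side of \<open>f c\<close> and close to it forces \<open>f y = f z\<close>.\<close>

section \<open>Critical points, extrema and local injectivity\<close>

lemma open_image_inj:
  fixes g :: "real \<Rightarrow> real"
  assumes "continuous_on {0..1} g" "open W" "W \<subseteq> {0..1}" "inj_on g W"
  shows "open (g ` W)"
  using invariance_of_domain[of W g] assms continuous_on_subset by blast

lemma noncritical_obtains:
  assumes "c \<in> {0<..<1}" "c \<notin> critical_points g"
  obtains d where "d > 0" "{c-d<..<c+d} \<subseteq> {0<..<1}" "inj_on g {c-d<..<c+d}"
proof -
  obtain a b where ab: "0 \<le> a" "b \<le> 1" "c \<in> {a<..<b}" "inj_on g {a<..<b}"
    using assms unfolding critical_points_def by blast
  define d where "d = min (c - a) (b - c)"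
  have sub: "{c-d<..<c+d} \<subseteq> {a<..<b}"
    by (auto simp: d_def)
  show ?thesis
  proof
    show "d > 0" using ab by (auto simp: d_def)
    show "{c-d<..<c+d} \<subseteq> {0<..<1}" using sub ab by auto
    show "inj_on g {c-d<..<c+d}" using sub ab inj_on_subset by blast
  qed
qed

text \<open>If \<open>c\<close> were not critical, \<open>g\<close> would be injective near
  \<open>c\<close>. By invariance of domain it would then be open there and take values on both
  sides of \<open>g c\<close> inside the interval.\<close>

lemma local_extremum_critical:
  fixes g :: "real \<Rightarrow> real"
  assumes "continuous_on {0..1} g" "0 \<le> a" "b \<le> 1" "c \<in> {a<..<b}"
    and "(\<forall>t\<in>{a<..<b}. g t \<le> g c) \<or> (\<forall>t\<in>{a<..<b}. g c \<le> g t)"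
  shows "c \<in> critical_points g"
proof (rule ccontr)
  assume "c \<notin> critical_points g"
  then obtain d where d: "d > 0" "{c-d<..<c+d} \<subseteq> {0<..<1}" "inj_on g {c-d<..<c+d}"
    using noncritical_obtains[of c g] assms by auto
  define W where "W = {a<..<b} \<inter> {c-d<..<c+d}"
  have "open (g ` W)"
  proof (rule open_image_inj[OF assms(1)])
    show "open W" by (auto simp: W_def)
    show "W \<subseteq> {0..1}" using d(2) by (force simp: W_def)
    show "inj_on g W" using d(3) by (rule inj_on_subset) (auto simp: W_def)
  qed
  moreover have "g c \<in> g ` W" using assms d by (auto simp: W_def)
  ultimately obtain e where e: "e > 0" "ball (g c) e \<subseteq> g ` W"
    using open_contains_ball by blast
  have "g c + e/2 \<in> g ` W" "g c - e/2 \<in> g ` W"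
    using e by (auto simp: dist_real_def subset_iff)
  then obtain s t where "s \<in> W" "t \<in> W" "g s = g c + e/2" "g t = g c - e/2"
    by (metis imageE)
  then show False using assms(5) e(1) by (force simp: W_def)
qed

text \<open>This passes from local to global injectivity. If \<open>g u = g w\<close>, then either
  an extremum over the closed interval is attained inside, or both are attained at its ends and
  \<open>g\<close> is constant. Either way there is an interior extremum, hence a critical
  point.\<close>

lemma inj_on_noncritical_interval:
  fixes g :: "real \<Rightarrow> real"
  assumes cont: "continuous_on {0..1} g" and ab: "0 \<le> a" "b \<le> 1"
    and nc: "{a<..<b} \<inter> critical_points g = {}"
  shows "inj_on g {a<..<b}"
proof (rule linorder_inj_onI')
  fix u w assume uw: "u \<in> {a<..<b}" "w \<in> {a<..<b}" "u < w"
  have cont': "continuous_on {u..w} g"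
    using uw ab by (intro continuous_on_subset[OF cont]) auto
  have noext: "\<not> ((\<forall>t\<in>{u<..<w}. g t \<le> g m) \<or> (\<forall>t\<in>{u<..<w}. g m \<le> g t))" 
    if "m \<in> {u<..<w}" for m
  proof
    assume "(\<forall>t\<in>{u<..<w}. g t \<le> g m) \<or> (\<forall>t\<in>{u<..<w}. g m \<le> g t)"
    then have "m \<in> critical_points g"
      using that uw ab by (intro local_extremum_critical[OF cont, of u w m]) auto
    moreover have "m \<in> {a<..<b}" using that uw by auto
    ultimately show False using nc by blast
  qed
  show "g u \<noteq> g w"
  proof
    assume eq: "g u = g w"
    obtain p where p: "p \<in> {u..w}" "\<And>t. t \<in> {u..w} \<Longrightarrow> g t \<le> g p"
      using continuous_attains_sup[OF _ _ cont'] uw by fastforce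
    obtain q where q: "q \<in> {u..w}" "\<And>t. t \<in> {u..w} \<Longrightarrow> g q \<le> g t"
      using continuous_attains_inf[OF _ _ cont'] uw by fastforce
    have "p \<notin> {u<..<w}" "q \<notin> {u<..<w}"
      using noext[of p] noext[of q] p(2) q(2) by auto
    then have "g p = g u" "g q = g u" using p(1) q(1) eq by (auto simp: order_le_less)
    then have const: "g t = g u" if "t \<in> {u..w}" for t using p(2) q(2) that by force
    have m: "(u + w) / 2 \<in> {u<..<w}" using uw by simp
    have "g t \<le> g ((u + w) / 2)" if "t \<in> {u<..<w}" for t
      using const[of t] const[of "(u + w) / 2"] that m by simp
    then show False using noext[OF m] by blast
  qed
qed

section \<open>One-sided behaviour and finiteness of fibres\<close>

lemma one_sided_inj:
  fixes g :: "real \<Rightarrow> real"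
  assumes cont: "continuous_on {0..1} g" and pm: "piecewise_monotone g" and c: "c \<in> {0..1}"
  obtains e where "e > 0" "inj_on g ({c-e<..<c} \<inter> {0..1})" "inj_on g ({c<..<c+e} \<inter> {0..1})"
proof -
  \<comment> \<open>Adding the endpoints to the avoided set keeps both one-sided intervals inside
    \<open>{0..1}\<close>, unless \<open>c\<close> is itself an endpoint; then the outer side is
    empty.\<close>
  have "finite (critical_points g \<union> {0,1})" using pm by (simp add: piecewise_monotone_def)
  then obtain e where e: "e > 0" "\<And>x. x \<in> critical_points g \<union> {0,1} \<Longrightarrow> x \<noteq> c \<Longrightarrow> e \<le> dist c x"
    using finite_set_avoid by metis
  show ?thesis
  proof
    show "inj_on g ({c-e<..<c} \<inter> {0..1})"
    proof (cases "c = 0")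
      case False
      then have "0 \<le> c - e" using e(2)[of 0] c by (auto simp: dist_real_def)
      then have "inj_on g {c-e<..<c}"
        using c e(2) by (intro inj_on_noncritical_interval[OF cont]) (force simp: dist_real_def)+
      then show ?thesis by (rule inj_on_subset) auto
    qed (auto simp: inj_on_def)
    show "inj_on g ({c<..<c+e} \<inter> {0..1})"
    proof (cases "c = 1")
      case False
      then have "c + e \<le> 1" using e(2)[of 1] c by (auto simp: dist_real_def)
      then have "inj_on g {c<..<c+e}"
        using c e(2) by (intro inj_on_noncritical_interval[OF cont]) (force simp: dist_real_def)+
      then show ?thesis by (rule inj_on_subset) auto
    qed (auto simp: inj_on_def)
  qed (fact e(1))
qed

text \<open>An infinite fibre would accumulate at some \<open>c\<close>, but injectivity on each
  side of \<open>c\<close> leaves at most one point of the fibre there.\<close>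

lemma finite_interval_fibre:
  fixes g :: "real \<Rightarrow> real"
  assumes cont: "continuous_on {0..1} g" and pm: "piecewise_monotone g"
  shows "finite (interval_fibre g v)"
proof (rule ccontr)
  let ?F = "interval_fibre g v"
  assume "infinite ?F"
  moreover have "?F \<subseteq> {0..1}" by (auto simp: interval_fibre_def)
  ultimately obtain c where c: "c \<in> {0..1}" "c islimpt ?F"
    using Heine_Borel_imp_Bolzano_Weierstrass[OF compact_Icc] by blast
  obtain e where e: "e > 0" "inj_on g ({c-e<..<c} \<inter> {0..1})" "inj_on g ({c<..<c+e} \<inter> {0..1})"
    using one_sided_inj[OF cont pm c(1)] .
  have fin: "finite (?F \<inter> A)" if "inj_on g (A \<inter> {0..1})" for A
  proof (rule finite_imageD)
    show "finite (g ` (?F \<inter> A))"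
      by (rule finite_subset[of _ "{v}"]) (auto simp: interval_fibre_def)
    show "inj_on g (?F \<inter> A)"
      using that by (rule inj_on_subset) (auto simp: interval_fibre_def)
  qed
  have "?F \<inter> ball c e \<subseteq> insert c ((?F \<inter> {c-e<..<c}) \<union> (?F \<inter> {c<..<c+e}))"
    by (auto simp: dist_real_def)
  then have "finite (?F \<inter> ball c e)"
    using fin[OF e(2)] fin[OF e(3)] finite_subset by blast
  then show False using c(2) e(1) by (simp add: islimpt_eq_infinite_ball)
qed

lemma constant_sign_interval:
  fixes g :: "real \<Rightarrow> real"
  assumes "continuous_on S g" "connected S" "\<And>t. t \<in> S \<Longrightarrow> g t \<noteq> v"
  shows "(\<forall>t\<in>S. g t < v) \<or> (\<forall>t\<in>S. v < g t)"
proof (rule ccontr)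
  assume "\<not> ?thesis"
  then obtain s t where "s \<in> S" "t \<in> S" "g s \<le> v" "v \<le> g t" by (meson not_less)
  then have "v \<in> g ` S"
    using connectedD_interval[OF connected_continuous_image[OF assms(1,2)], of "g s" "g t" v] by auto
  then show False using assms(3) by auto
qed

text \<open>A finite fibre leaves a gap around \<open>c\<close> in which \<open>g\<close> does not
  return to the value \<open>g c\<close>; connectedness then fixes the sign on each side.\<close>

lemma one_sided_sign:
  fixes g :: "real \<Rightarrow> real"
  assumes cont: "continuous_on {0..1} g" and pm: "piecewise_monotone g"
  obtains e where "e > 0"
    "(\<forall>t\<in>{c-e<..<c}\<inter>{0..1}. g t < g c) \<or> (\<forall>t\<in>{c-e<..<c}\<inter>{0..1}. g c < g t)"
    "(\<forall>t\<in>{c<..<c+e}\<inter>{0..1}. g t < g c) \<or> (\<forall>t\<in>{c<..<c+e}\<inter>{0..1}. g c < g t)"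
proof -
  obtain e where e: "e > 0" "\<And>x. x \<in> interval_fibre g (g c) \<Longrightarrow> x \<noteq> c \<Longrightarrow> e \<le> dist c x"
    using finite_set_avoid[OF finite_interval_fibre[OF cont pm]] by metis
  have conn: "connected (A \<inter> {0..1::real})" if "convex A" for A
    using that by (intro convex_connected convex_Int) auto
  have "g t \<noteq> g c" if "t \<in> ({c-e<..<c} \<union> {c<..<c+e}) \<inter> {0..1}" for t
    using e(2)[of t] that by (auto simp: interval_fibre_def dist_real_def)
  then show ?thesis
    by (intro that[OF e(1)] constant_sign_interval conn continuous_on_subset[OF cont]) auto
qed

text \<open>\<open>g\<close> lies strictly to one side of \<open>g c\<close> on the left of
  \<open>c\<close>, and likewise on the right. Opposite sides would make \<open>g\<close> injective
  around an interior \<open>c\<close>, so they agree.\<close>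

lemma singular_strict_extremum:
  fixes g :: "real \<Rightarrow> real"
  assumes cont: "continuous_on {0..1} g" and pm: "piecewise_monotone g"
    and c: "c \<in> critical_points g \<union> {0,1}"
  obtains e where "e > 0"
    "(\<forall>t\<in>{0..1}. t \<noteq> c \<and> \<bar>t - c\<bar> < e \<longrightarrow> g t < g c) \<or>
     (\<forall>t\<in>{0..1}. t \<noteq> c \<and> \<bar>t - c\<bar> < e \<longrightarrow> g c < g t)"
proof -
  have c01: "c \<in> {0..1}" using c by (auto simp: critical_points_def)
  obtain e1 where e1: "e1 > 0"
    "(\<forall>t\<in>{c-e1<..<c}\<inter>{0..1}. g t < g c) \<or> (\<forall>t\<in>{c-e1<..<c}\<inter>{0..1}. g c < g t)"
    "(\<forall>t\<in>{c<..<c+e1}\<inter>{0..1}. g t < g c) \<or> (\<forall>t\<in>{c<..<c+e1}\<inter>{0..1}. g c < g t)"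
    using one_sided_sign[OF cont pm] .
  obtain e2 where e2: "e2 > 0" "inj_on g ({c-e2<..<c} \<inter> {0..1})" "inj_on g ({c<..<c+e2} \<inter> {0..1})"
    using one_sided_inj[OF cont pm c01] .
  define e where "e = min e1 e2"
  define L where "L = {c-e<..<c} \<inter> {0..1}"
  define R where "R = {c<..<c+e} \<inter> {0..1}"
  have e: "e > 0" using e1 e2 by (simp add: e_def)
  have inj: "inj_on g L" "inj_on g R"
    by (rule inj_on_subset[OF e2(2)] inj_on_subset[OF e2(3)], force simp: L_def R_def e_def)+
  have signs: "(\<forall>t\<in>L. g t < g c) \<or> (\<forall>t\<in>L. g c < g t)"
    "(\<forall>t\<in>R. g t < g c) \<or> (\<forall>t\<in>R. g c < g t)"
    using e1(2,3) by (force simp: L_def R_def e_def)+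
  have not_mixed: False 
    if mixed: "(\<forall>t\<in>L. g t < g c) \<and> (\<forall>t\<in>R. g c < g t) \<or>
      (\<forall>t\<in>L. g c < g t) \<and> (\<forall>t\<in>R. g t < g c)" and interior: "c \<notin> {0,1}"
  proof -
    let ?A = "{max 0 (c - e)<..<min 1 (c + e)}"
    have crit: "c \<in> critical_points g" and "c \<in> {0<..<1}" 
      using c interior by (auto simp: critical_points_def)
    then have "\<not> inj_on g ?A"
      using e unfolding critical_points_def by fastforce
    \<comment> \<open>The value \<open>g c\<close> separates the images of \<open>L\<close> and
      \<open>R\<close>, so injectivity on the pieces glues.\<close>
    moreover have "inj_on g (L \<union> {c} \<union> R)"
      using inj mixed by (fastforce simp: inj_on_Un)
    then have "inj_on g ?A"
      by (rule inj_on_subset) (auto simp: L_def R_def)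
    ultimately show False by simp
  qed
  have LR: "t \<in> L \<union> R" if "t \<in> {0..1}" "t \<noteq> c \<and> \<bar>t - c\<bar> < e" for t
    using that by (auto simp: L_def R_def)
  \<comment> \<open>At an endpoint one side is empty, and the sign on the other side decides
    alone.\<close>
  have "L = {}" if "c = 0" using that by (auto simp: L_def)
  moreover have "R = {}" if "c = 1" using that by (auto simp: R_def)
  ultimately have "(\<forall>t\<in>L \<union> R. g t < g c) \<or> (\<forall>t\<in>L \<union> R. g c < g t)"
    using signs not_mixed by auto
  then show ?thesis using LR by (intro that[OF e]) blast
qed

lemma extremum_near:
  fixes g :: "real \<Rightarrow> real"
  assumes "e > 0" "(\<forall>t\<in>{0..1}. t \<noteq> c \<and> \<bar>t - c\<bar> < e \<longrightarrow> g t < g c) \<or>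
     (\<forall>t\<in>{0..1}. t \<noteq> c \<and> \<bar>t - c\<bar> < e \<longrightarrow> g c < g t)"
  obtains "\<forall>t\<in>{0..1}. \<bar>t - c\<bar> < e \<longrightarrow> g t \<le> g c" | "\<forall>t\<in>{0..1}. \<bar>t - c\<bar> < e \<longrightarrow> g c \<le> g t"
  using assms by (metis less_imp_le order_refl)

section \<open>Singular values and the commutation relation\<close>

text \<open>The endpoints are included so that every preimage in \<open>{0..1}\<close> of any other
  value is an interior point with a neighbourhood on which \<open>g\<close> is injective.\<close>

definition singular_values :: "(real \<Rightarrow> real) \<Rightarrow> real set" where
  "singular_values g = g ` (critical_points g \<union> {0,1})"

lemma finite_singular_values: "piecewise_monotone g \<Longrightarrow> finite (singular_values g)"
  by (simp add: singular_values_def piecewise_monotone_def)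

text \<open>The inclusion of g^{-1} o f in f o g^{-1}, phrased as joint solvability of two
  equations.\<close>

lemma commutes_with_inverse_lift:
  assumes "commutes_with_inverse f g" "x \<in> {0..1}" "z \<in> {0..1}" "g z = f x"
  obtains y where "y \<in> {0..1}" "g y = x" "f y = z"
proof -
  have "z \<in> f ` interval_fibre g x"
    using assms unfolding commutes_with_inverse_def by (auto simp: interval_fibre_def)
  then show ?thesis using that by (auto simp: interval_fibre_def)
qed

text \<open>The opposite inclusion, applied to \<open>f y\<close> as an element of f(g^{-1}(g
  y)).\<close>

lemma commutes_with_inverse_commute:
  assumes "commutes_with_inverse f g" "g ` {0..1} = {0..1}" "y \<in> {0..1}"
  shows "g (f y) = f (g y)"
proof -
  have "g y \<in> {0..1}" using assms by blast
  moreover have "f y \<in> f ` interval_fibre g (g y)"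
    using assms by (auto simp: interval_fibre_def)
  ultimately show ?thesis
    using assms(1) unfolding commutes_with_inverse_def by (auto simp: interval_fibre_def)
qed

text \<open>Lift \<open>(t, c)\<close> to a point \<open>y\<close> with \<open>g y = t\<close> and \<open>f y = c\<close>. As \<open>g\<close> is open at \<open>y\<close>, every
  point near \<open>t\<close> is \<open>g w\<close> with \<open>w\<close> near \<open>y\<close>, and \<open>f (g w) = g (f w)\<close> with \<open>f w\<close> near \<open>c\<close>.\<close>
lemma commutes_with_inverse_transfer:
  fixes f g :: "real \<Rightarrow> real"
  assumes f: "continuous_on {0..1} f" "f ` {0..1} = {0..1}"
    and g: "continuous_on {0..1} g" "g ` {0..1} = {0..1}"
    and comm: "commutes_with_inverse f g"
    and t: "t \<in> {0..1}" "t \<notin> singular_values g" "f t = g c"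
    and c: "c \<in> {0..1}" "e > 0" "\<And>s. s \<in> {0..1} \<Longrightarrow> \<bar>s - c\<bar> < e \<Longrightarrow> P (g s)"
  shows "\<forall>\<^sub>F s in nhds t. P (f s)"
proof -
  obtain y where y: "y \<in> {0..1}" "g y = t" "f y = c"
    using commutes_with_inverse_lift[OF comm t(1) c(1)] t(3) by auto
  have "y \<notin> critical_points g \<union> {0,1}"
    using t(2) y(2) by (auto simp: singular_values_def)
  then obtain d where d: "d > 0" "{y-d<..<y+d} \<subseteq> {0<..<1}" "inj_on g {y-d<..<y+d}"
    using noncritical_obtains[of y g] y(1) by auto
  obtain d' where d': "d' > 0" "\<And>w. w \<in> {0..1} \<Longrightarrow> dist w y < d' \<Longrightarrow> dist (f w) (f y) < e"
    using f(1) y(1) c(2) unfolding continuous_on_iff by metis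
  define W where "W = {y-d<..<y+d} \<inter> ball y d'"
  have W01: "W \<subseteq> {0..1}" using d(2) by (force simp: W_def)
  have "open (g ` W)"
    by (rule open_image_inj[OF g(1) _ W01])
      (auto simp: W_def intro: inj_on_subset[OF d(3)])
  moreover have "t \<in> g ` W" using y d(1) d'(1) by (auto simp: W_def)
  moreover have "P (f s)" if s: "s \<in> g ` W" for s
  proof -
    obtain w where w: "w \<in> W" "s = g w" using s by blast
    then have "w \<in> {0..1}" "f w \<in> {0..1}" using W01 f(2) by blast+
    moreover have "\<bar>f w - c\<bar> < e"
      using d'(2)[of w] w(1) \<open>w \<in> {0..1}\<close> y(3) by (auto simp: W_def dist_real_def abs_minus_commute)
    ultimately show ?thesis
      using c(3) commutes_with_inverse_commute[OF comm g(2)] w(2) by force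
  qed
  ultimately show ?thesis by (auto simp: eventually_nhds)
qed

text \<open>Write \<open>v = g c\<close> with an extremum of \<open>g\<close> at \<open>c\<close>.
  If it is a maximum, the truth value of \<open>f t \<le> v\<close> is locally constant on
  \<open>X\<close>: by continuity where \<open>f t\<close> differs from \<open>v\<close>, and by
  transfer of the maximum to \<open>t\<close> where they agree. A minimum gives the same for
  \<open>v \<le> f t\<close>. Connectedness of \<open>X\<close> concludes.\<close>

lemma commutes_with_inverse_same_side:
  fixes f g :: "real \<Rightarrow> real"
  assumes f: "continuous_on {0..1} f" "f ` {0..1} = {0..1}"
    and g: "continuous_on {0..1} g" "g ` {0..1} = {0..1}" "piecewise_monotone g"
    and comm: "commutes_with_inverse f g"
    and X: "connected X" "X \<subseteq> {0..1}" "X \<inter> singular_values g = {}" "x \<in> X" "x' \<in> X"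
    and v: "v \<in> singular_values g" "f x \<noteq> v" "f x' \<noteq> v"
  shows "v < f x \<longleftrightarrow> v < f x'"
proof -
  obtain c where c: "c \<in> critical_points g \<union> {0,1}" "v = g c"
    using v(1) by (auto simp: singular_values_def)
  then have c01: "c \<in> {0..1}" by (auto simp: critical_points_def)
  obtain e where e: "e > 0"
    "(\<forall>t\<in>{0..1}. t \<noteq> c \<and> \<bar>t - c\<bar> < e \<longrightarrow> g t < g c) \<or>
     (\<forall>t\<in>{0..1}. t \<noteq> c \<and> \<bar>t - c\<bar> < e \<longrightarrow> g c < g t)"
    using singular_strict_extremum[OF g(1,3) c(1)] .
  note transfer = commutes_with_inverse_transfer[OF f g(1,2) comm _ _ _ c01 e(1)]
  have lim: "(f \<longlongrightarrow> f t) (at t within X)" if "t \<in> X" for t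
    using f(1) X(2) that by (meson continuous_on_def continuous_on_subset)
  from e show ?thesis
  proof (cases rule: extremum_near)
    case 1
    have "\<forall>\<^sub>F s in at t within X. (f t \<le> v) = (f s \<le> v)" if t: "t \<in> X" for t
    proof (cases "f t" v rule: linorder_cases)
      case less
      then show ?thesis using order_tendstoD(2)[OF lim[OF t] less] by (auto elim: eventually_mono)
    next
      case greater
      then show ?thesis using order_tendstoD(1)[OF lim[OF t] greater] by (auto elim: eventually_mono)
    next
      case equal
      have "\<forall>\<^sub>F s in nhds t. f s \<le> v"
        by (rule transfer[where P = "\<lambda>r. r \<le> v"]) (use t X equal c(2) 1 in auto)
      then show ?thesis using equal by (auto simp: eventually_at_filter elim: eventually_mono)
    qed
    from connected_local_const[OF X(1,4,5), of "\<lambda>t. f t \<le> v"] this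
    show ?thesis using v by auto
  next
    case 2
    have "\<forall>\<^sub>F s in at t within X. (v \<le> f t) = (v \<le> f s)" if t: "t \<in> X" for t
    proof (cases "f t" v rule: linorder_cases)
      case less
      then show ?thesis using order_tendstoD(2)[OF lim[OF t] less] by (auto elim: eventually_mono)
    next
      case greater
      then show ?thesis using order_tendstoD(1)[OF lim[OF t] greater] by (auto elim: eventually_mono)
    next
      case equal
      have "\<forall>\<^sub>F s in nhds t. v \<le> f s"
        by (rule transfer[where P = "\<lambda>r. v \<le> r"]) (use t X equal c(2) 2 in auto)
      then show ?thesis using equal by (auto simp: eventually_at_filter elim: eventually_mono)
    qed
    from connected_local_const[OF X(1,4,5), of "\<lambda>t. v \<le> f t"] this
    show ?thesis using v by auto
  qed
qed

section \<open>Cardinality of the fibres\<close>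

text \<open>Around the finitely many preimages of \<open>x\<close> there are disjoint balls on which
  \<open>g\<close> is injective. A value close to \<open>x\<close> has exactly one preimage in each
  ball and none elsewhere.\<close>

lemma card_fibre_locally_constant:
  fixes g :: "real \<Rightarrow> real"
  assumes cont: "continuous_on {0..1} g" and pm: "piecewise_monotone g"
    and x: "x \<notin> singular_values g"
  shows "\<forall>\<^sub>F x' in nhds x. card (interval_fibre g x') = card (interval_fibre g x)"
proof -
  let ?Y = "interval_fibre g x"
  have fin: "finite ?Y" using finite_interval_fibre[OF cont pm] .
  have "\<forall>y\<in>?Y. \<exists>r>0. ball y r \<subseteq> {0..1} \<and> inj_on g (ball y r) \<and> (\<forall>y'\<in>?Y. y' \<noteq> y \<longrightarrow> 2 * r \<le> dist y y')"
  proof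
    fix y assume y: "y \<in> ?Y"
    then have "y \<notin> critical_points g \<union> {0,1}" "y \<in> {0..1}"
      using x by (auto simp: singular_values_def interval_fibre_def)
    then obtain d where d: "d > 0" "{y-d<..<y+d} \<subseteq> {0<..<1}" "inj_on g {y-d<..<y+d}"
      using noncritical_obtains[of y g] by auto
    obtain e where e: "e > 0" "\<forall>y'\<in>?Y. y' \<noteq> y \<longrightarrow> e \<le> dist y y'"
      using finite_set_avoid[OF fin] by metis
    \<comment> \<open>Half the gap between points of the fibre makes the balls disjoint.\<close>
    define r where "r = min d (e/2)"
    have sub: "ball y r \<subseteq> {y-d<..<y+d}" by (auto simp: r_def dist_real_def)
    have "ball y r \<subseteq> {0..1}" using sub d(2) by force
    moreover have "\<forall>y'\<in>?Y. y' \<noteq> y \<longrightarrow> 2 * r \<le> dist y y'" using e(2) by (auto simp: r_def)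
    ultimately show "\<exists>r>0. ball y r \<subseteq> {0..1} \<and> inj_on g (ball y r) \<and>
        (\<forall>y'\<in>?Y. y' \<noteq> y \<longrightarrow> 2 * r \<le> dist y y')"
      using inj_on_subset[OF d(3) sub] d(1) e(1) by (intro exI[of _ r]) (auto simp: r_def)
  qed
  then obtain r where r: "\<And>y. y \<in> ?Y \<Longrightarrow> r y > 0" "\<And>y. y \<in> ?Y \<Longrightarrow> ball y (r y) \<subseteq> {0..1}"
    "\<And>y. y \<in> ?Y \<Longrightarrow> inj_on g (ball y (r y))"
    "\<And>y y'. y \<in> ?Y \<Longrightarrow> y' \<in> ?Y \<Longrightarrow> y' \<noteq> y \<Longrightarrow> 2 * r y \<le> dist y y'"
    by metis
  have disj: "y = y'" if "y \<in> ?Y" "y' \<in> ?Y" "w \<in> ball y (r y)" "w \<in> ball y' (r y')" for y y' w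
  proof (rule ccontr)
    assume "y \<noteq> y'"
    then have "2 * r y \<le> dist y y'" "2 * r y' \<le> dist y y'"
      using r(4)[of y y'] r(4)[of y' y] that by (auto simp: dist_commute)
    moreover have "dist y y' < r y + r y'"
      using that dist_triangle_less_add[of y w "r y" y' "r y'"] by (auto simp: dist_commute)
    ultimately show False by simp
  qed
  define U where "U = (\<Union>y\<in>?Y. ball y (r y))"
  \<comment> \<open>The image of the complement of the balls is closed and misses \<open>x\<close>,
    so values near \<open>x\<close> have no preimage outside \<open>U\<close>.\<close>
  have "compact (g ` ({0..1} - U))"
    by (intro compact_continuous_image continuous_on_subset[OF cont] compact_diff)
      (auto simp: U_def)
  then have "open (- (g ` ({0..1} - U)))" by (simp add: compact_imp_closed open_Compl)
  moreover have "x \<in> - (g ` ({0..1} - U))"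
    using r(1) by (force simp: U_def interval_fibre_def)
  ultimately have ev1: "\<forall>\<^sub>F x' in nhds x. x' \<in> - (g ` ({0..1} - U))"
    by (rule eventually_nhds_in_open)
  have "\<forall>\<^sub>F x' in nhds x. \<forall>y\<in>?Y. x' \<in> g ` ball y (r y)"
  proof (intro eventually_ball_finite[OF fin] ballI eventually_nhds_in_open)
    fix y assume y: "y \<in> ?Y"
    show "open (g ` ball y (r y))" using open_image_inj[OF cont _ r(2)[OF y] r(3)[OF y]] by simp
    show "x \<in> g ` ball y (r y)" using y r(1)[OF y] by (auto simp: interval_fibre_def)
  qed
  with ev1 show ?thesis
  proof eventually_elim
    case (elim x')
    then have "\<forall>y\<in>?Y. \<exists>w\<in>ball y (r y). g w = x'" by blast
    then obtain p where p: "\<And>y. y \<in> ?Y \<Longrightarrow> p y \<in> ball y (r y)" "\<And>y. y \<in> ?Y \<Longrightarrow> g (p y) = x'"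
      by metis
    have "p ` ?Y = interval_fibre g x'"
    proof (intro equalityI subsetI)
      fix w assume "w \<in> p ` ?Y"
      then obtain y where "y \<in> ?Y" "w = p y" by blast
      then have "w \<in> {0..1}" "g w = x'" using p r(2) by blast+
      then show "w \<in> interval_fibre g x'" by (simp add: interval_fibre_def)
    next
      fix w assume w: "w \<in> interval_fibre g x'"
      then have "w \<in> U" using elim(1) by (auto simp: interval_fibre_def)
      then obtain y where y: "y \<in> ?Y" "w \<in> ball y (r y)" unfolding U_def by blast
      have "g w = g (p y)" using p(2)[OF y(1)] w by (simp add: interval_fibre_def)
      then have "w = p y" using inj_onD[OF r(3)[OF y(1)]] y(2) p(1)[OF y(1)] by blast
      then show "w \<in> p ` ?Y" using y by blast
    qed
    moreover have "inj_on p ?Y" using disj p(1) by (metis inj_onI)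
    ultimately show ?case using card_image by metis
  qed
qed

lemma card_fibre_constant:
  fixes g :: "real \<Rightarrow> real"
  assumes "continuous_on {0..1} g" "piecewise_monotone g"
    and X: "connected X" "X \<inter> singular_values g = {}" "x \<in> X" "x' \<in> X"
  shows "card (interval_fibre g x) = card (interval_fibre g x')"
proof (rule connected_local_const[OF X(1,3,4)], rule ballI)
  fix t assume "t \<in> X"
  then have "\<forall>\<^sub>F s in nhds t. card (interval_fibre g s) = card (interval_fibre g t)"
    using card_fibre_locally_constant[OF assms(1,2)] X(2) by blast
  then show "\<forall>\<^sub>F s in at t within X. card (interval_fibre g t) = card (interval_fibre g s)"
    by (auto simp: eventually_at_filter elim: eventually_mono)
qed

text \<open>A component of \<open>{0..1} - singular_values g\<close> is encoded by the set \<open>L x\<close> of the singular values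
  below any of its points \<open>x\<close>.\<close>
lemma card_fibre_invariant:
  fixes f g :: "real \<Rightarrow> real"
  assumes f: "continuous_on {0..1} f" "f ` {0..1} = {0..1}" "piecewise_monotone f"
    and g: "continuous_on {0..1} g" "g ` {0..1} = {0..1}" "piecewise_monotone g"
    and comm: "commutes_with_inverse f g"
    and x: "x \<in> {0..1}" "x \<notin> singular_values g" "f x \<notin> singular_values g"
  shows "card (interval_fibre g (f x)) = card (interval_fibre g x)"
proof -
  define V where "V = singular_values g"
  define L where "L x = {v \<in> V. v < x}" for x
  define N where "N x = card (interval_fibre g x)" for x
  \<comment> \<open>\<open>X\<close> holds the generic points, \<open>rep\<close> picks one in a
    given component, and \<open>\<tau>\<close> is the map on components that \<open>f\<close>
    induces.\<close>
  define X where "X = {x \<in> {0..1}. x \<notin> V \<and> f x \<notin> V}"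
  define rep where "rep k = (SOME x. x \<in> X \<and> L x = k)" for k
  define \<tau> where "\<tau> k = L (f (rep k))" for k
  have finV: "finite V" using finite_singular_values[OF g(3)] by (simp add: V_def)
  have X_I: "X \<subseteq> {0..1}" by (auto simp: X_def)
  \<comment> \<open>The encoding is faithful: equal codes mean that no singular value separates the
    points.\<close>
  have no_V: "{min x x'..max x x'} \<inter> V = {}" if "x \<notin> V" "x' \<notin> V" "L x = L x'" for x x'
  proof (rule ccontr)
    assume "\<not> ?thesis"
    then obtain v where v: "v \<in> V" "min x x' \<le> v" "v \<le> max x x'" by auto
    then have "v \<noteq> x" "v \<noteq> x'" using that by auto
    moreover have "v < x \<longleftrightarrow> v < x'" using v(1) that(3) by (auto simp: L_def)
    ultimately show False using v by linarith
  qed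
  have N_L: "N x = N x'" if "x \<notin> V" "x' \<notin> V" "L x = L x'" for x x'
    unfolding N_def
    by (rule card_fibre_constant[OF g(1,3), of "{min x x'..max x x'}"])
      (use no_V[OF that] in \<open>auto simp: V_def\<close>)
  have f_L: "L (f x) = L (f x')" if "x \<in> X" "x' \<in> X" "L x = L x'" for x x'
  proof -
    have x: "x \<in> {0..1}" "x \<notin> V" "f x \<notin> V" "x' \<in> {0..1}" "x' \<notin> V" "f x' \<notin> V"
      using that by (auto simp: X_def)
    have "v < f x \<longleftrightarrow> v < f x'" if v: "v \<in> V" for v
      by (rule commutes_with_inverse_same_side[OF f(1,2) g comm, of "{min x x'..max x x'}"])
        (use no_V[OF x(2,5) \<open>L x = L x'\<close>] x v in \<open>auto simp: V_def\<close>)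
    then show ?thesis by (auto simp: L_def)
  qed
  \<comment> \<open>A component contains a nondegenerate interval, so finitely many points cannot
    exhaust it.\<close>
  have generic: "\<exists>z'\<in>{0..1} - V - B. L z' = L z" if z: "z \<in> {0..1} - V" and B: "finite B" for z B
  proof -
    obtain d where d: "d > 0" "\<forall>v\<in>V. v \<noteq> z \<longrightarrow> d \<le> dist z v"
      using finite_set_avoid[OF finV] by metis
    define a where "a = max 0 (z - d)"
    define b where "b = min 1 (z + d)"
    have "a < b" using z d(1) by (auto simp: a_def b_def)
    then have "infinite ({a<..<b} - B)" using B by (simp add: infinite_Ioo)
    then obtain z' where z': "z' \<in> {a<..<b}" "z' \<notin> B"
      by (metis Diff_iff all_not_in_conv finite.emptyI)
    then have near: "\<bar>z' - z\<bar> < d" "z' \<in> {0..1}" by (auto simp: a_def b_def)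
    have "v < z' \<longleftrightarrow> v < z" "v \<noteq> z'" if "v \<in> V" for v
    proof -
      have "d \<le> \<bar>z - v\<bar>" using d(2) that z by (auto simp: dist_real_def)
      then show "v < z' \<longleftrightarrow> v < z" "v \<noteq> z'" using near(1) by linarith+
    qed
    then have "z' \<notin> V" "L z' = L z" by (auto simp: L_def)
    then show ?thesis using near(2) z'(2) by blast
  qed
  have rep: "rep (L x) \<in> X" "L (rep (L x)) = L x" if "x \<in> X" for x
    using someI[of "\<lambda>y. y \<in> X \<and> L y = L x" x] that by (auto simp: rep_def)
  have \<tau>_L: "\<tau> (L x) = L (f x)" if "x \<in> X" for x
    using f_L[OF rep(1)[OF that] that rep(2)[OF that]] by (simp add: \<tau>_def)
  have L_X: "L z \<in> L ` X" if z: "z \<in> {0..1} - V" for z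
  proof -
    have "finite {x \<in> {0..1}. f x \<in> V}"
    proof (rule finite_subset)
      show "{x \<in> {0..1}. f x \<in> V} \<subseteq> (\<Union>v\<in>V. interval_fibre f v)"
        by (auto simp: interval_fibre_def)
      show "finite (\<Union>v\<in>V. interval_fibre f v)"
        using finV finite_interval_fibre[OF f(1,3)] by blast
    qed
    then obtain z' where "z' \<in> {0..1} - V - {x \<in> {0..1}. f x \<in> V}" "L z' = L z"
      using generic[OF z] by blast
    then have "z' \<in> X" "L z = L z'" by (auto simp: X_def)
    then show ?thesis by blast
  qed
  have f_I: "f x \<in> {0..1} - V" if "x \<in> X" for x
    using that f(2) by (auto simp: X_def)
  have "\<tau> ` L ` X = L ` X"
  proof (intro equalityI subsetI)
    fix k assume "k \<in> \<tau> ` L ` X"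
    then obtain x where "x \<in> X" "k = L (f x)" using \<tau>_L by auto
    then show "k \<in> L ` X" using L_X f_I by blast
  next
    fix k assume "k \<in> L ` X"
    then obtain z where z: "z \<in> {0..1} - V" "k = L z" by (auto simp: X_def)
    \<comment> \<open>Since \<open>z'\<close> avoids the image of \<open>V\<close> under
      \<open>f\<close>, any preimage of it lies outside \<open>V\<close> and is generic.\<close>
    obtain z' where z': "z' \<in> {0..1} - V - f ` V" "L z' = L z"
      using generic[OF z(1), of "f ` V"] finV by blast
    then obtain x where "x \<in> {0..1}" "z' = f x" using f(2) by blast
    then have "x \<in> X" using z' by (auto simp: X_def)
    then have "\<tau> (L x) = k" using \<tau>_L z' z(2) \<open>z' = f x\<close> by simp
    then show "k \<in> \<tau> ` L ` X" using \<open>x \<in> X\<close> by blast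
  qed
  \<comment> \<open>Codes are subsets of the finite set \<open>V\<close>, so the surjection
    \<open>\<tau>\<close> on them is a permutation.\<close>
  moreover have finK: "finite (L ` X)"
    using finV by (intro finite_subset[of "L ` X" "Pow V"]) (auto simp: L_def)
  ultimately have bij: "bij_betw \<tau> (L ` X) (L ` X)"
    by (simp add: bij_betw_def eq_card_imp_inj_on)
  \<comment> \<open>By commutation \<open>f\<close> maps the fibre over \<open>x\<close> onto the
    fibre over \<open>f x\<close>.\<close>
  have le: "N (f x) \<le> N x" if "x \<in> X" for x
  proof -
    have "f ` interval_fibre g x = interval_fibre g (f x)"
      using comm that by (auto simp: commutes_with_inverse_def X_def)
    then show ?thesis
      unfolding N_def using card_image_le[OF finite_interval_fibre[OF g(1,3)]] by metis
  qed
  have N_rep: "N (rep (L x)) = N x" if "x \<in> X" for x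
    using N_L[OF _ _ rep(2)[OF that]] rep(1)[OF that] that by (auto simp: X_def)
  have N_\<tau>: "N (rep (\<tau> (L x))) = N (f x)" if x: "x \<in> X" for x
  proof -
    obtain x' where x': "x' \<in> X" "L x' = L (f x)" using L_X[OF f_I[OF x]] by auto
    then have "N x' = N (f x)" using N_L[of x' "f x"] f_I[OF x] by (auto simp: X_def)
    then show ?thesis using N_rep[OF x'(1)] x'(2) \<tau>_L[OF x] by simp
  qed
  \<comment> \<open>A permutation preserves the sum of the fibre sizes; as no term increases, every
    term is unchanged.\<close>
  have "(\<Sum>k\<in>L ` X. N (rep (\<tau> k))) = (\<Sum>k\<in>L ` X. N (rep k))"
    by (rule sum.reindex_bij_betw[OF bij])
  moreover have "N (rep (\<tau> k)) \<le> N (rep k)" if "k \<in> L ` X" for k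
    using that le N_rep N_\<tau> by auto
  moreover have "x \<in> X" using x by (simp add: X_def V_def)
  ultimately have "N (rep (\<tau> (L x))) = N (rep (L x))"
    using sum_mono_inv[OF _ _ _ finK, of "\<lambda>k. N (rep (\<tau> k))" "\<lambda>k. N (rep k)" "L x"] by blast
  then show ?thesis
    using N_\<tau>[OF \<open>x \<in> X\<close>] N_rep[OF \<open>x \<in> X\<close>] by (simp add: N_def)
qed

section \<open>Folding at a common critical point\<close>

text \<open>Just left of \<open>c\<close> the values of \<open>g\<close> lie between
  \<open>g r\<close> and \<open>g c\<close> for a fixed \<open>r\<close> right of \<open>c\<close>,
  so the intermediate value theorem yields the match.\<close>

lemma strict_max_matching:
  fixes g :: "real \<Rightarrow> real"
  assumes cont: "continuous_on {0..1} g" and c: "c \<in> {0<..<1}" and e: "e > 0"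
    and max: "\<And>t. t \<in> {0..1} \<Longrightarrow> t \<noteq> c \<Longrightarrow> \<bar>t - c\<bar> < e \<Longrightarrow> g t < g c"
  obtains d where "d > 0" "\<And>y. y \<in> {c-d<..<c} \<Longrightarrow> \<exists>z\<in>{c<..<c+e} \<inter> {0..1}. g z = g y"
proof -
  \<comment> \<open>\<open>r\<close> must lie strictly within distance \<open>e\<close> of
    \<open>c\<close>, hence the half, and must not pass 1.\<close>
  define r where "r = c + min (e/2) (1 - c)"
  have r: "c < r" "r < c + e" "r \<le> 1" using c e by (auto simp: r_def min_def)
  then have gr: "g r < g c" using c by (intro max) auto
  obtain d where d: "d > 0" "\<And>t. t \<in> {0..1} \<Longrightarrow> dist t c < d \<Longrightarrow> dist (g t) (g c) < g c - g r"
    using cont c gr unfolding continuous_on_iff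
    by (metis diff_gt_0_iff_gt greaterThanLessThan_subseteq_atLeastAtMost_iff order_refl subsetD)
  show ?thesis
  proof
    show "min (min d e) c > 0" using d e c by auto
    fix y assume y: "y \<in> {c - min (min d e) c<..<c}"
    then have "y \<in> {0..1}" "\<bar>y - c\<bar> < d" "\<bar>y - c\<bar> < e" "y \<noteq> c" using c by auto
    then have gy: "g y < g c" "g r < g y" using max d(2)[of y] by (auto simp: dist_real_def)
    have "continuous_on {c..r} g" using c r by (intro continuous_on_subset[OF cont]) auto
    then obtain z where "z \<in> {c..r}" "g z = g y"
      using IVT2'[of g r "g y" c] gy r by auto
    then show "\<exists>z\<in>{c<..<c+e} \<inter> {0..1}. g z = g y" using gy r c by (intro bexI[of _ z]) (auto simp: order_le_less)
  qed
qed

text \<open>This supplies a whole interval of points \<open>y\<close> at which \<open>f\<close>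
  fails to be injective on the \<open>g\<close>-fibre through \<open>y\<close>, so that
  \<open>y\<close> can later be chosen generic.\<close>

lemma common_critical_point_fold:
  fixes f g :: "real \<Rightarrow> real"
  assumes f: "continuous_on {0..1} f" "f ` {0..1} = {0..1}" "piecewise_monotone f"
    and g: "continuous_on {0..1} g" "g ` {0..1} = {0..1}" "piecewise_monotone g"
    and comm: "commutes_with_inverse f g"
    and c: "c \<in> critical_points f" "c \<in> critical_points g"
  obtains d where "0 < d" "d \<le> c"
    "\<forall>y\<in>{c-d<..<c}. \<exists>z\<in>{0..1}. z \<noteq> y \<and> g z = g y \<and> f z = f y"
proof -
  have c01: "c \<in> {0<..<1}" using c by (auto simp: critical_points_def)
  obtain e1 where e1: "e1 > 0"
    "(\<forall>t\<in>{0..1}. t \<noteq> c \<and> \<bar>t - c\<bar> < e1 \<longrightarrow> f t < f c) \<or>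
     (\<forall>t\<in>{0..1}. t \<noteq> c \<and> \<bar>t - c\<bar> < e1 \<longrightarrow> f c < f t)"
    using singular_strict_extremum[OF f(1,3)] c(1) by blast
  obtain e2 where e2: "e2 > 0"
    "(\<forall>t\<in>{0..1}. t \<noteq> c \<and> \<bar>t - c\<bar> < e2 \<longrightarrow> g t < g c) \<or>
     (\<forall>t\<in>{0..1}. t \<noteq> c \<and> \<bar>t - c\<bar> < e2 \<longrightarrow> g c < g t)"
    using singular_strict_extremum[OF g(1,3)] c(2) by blast
  have "f c \<in> {0..1}" using f(2) c01 by auto
  then obtain \<epsilon> where \<epsilon>: "\<epsilon> > 0" "inj_on g ({f c-\<epsilon><..<f c} \<inter> {0..1})"
    "inj_on g ({f c<..<f c+\<epsilon>} \<inter> {0..1})"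
    using one_sided_inj[OF g(1,3)] by blast
  have "c \<in> {0..1}" using c01 by auto
  \<comment> \<open>Within \<open>e3\<close> of \<open>c\<close>, \<open>f\<close> stays in the
    range around \<open>f c\<close> where \<open>g\<close> is injective on each side.\<close>
  then obtain e3 where e3: "e3 > 0" "\<And>t. t \<in> {0..1} \<Longrightarrow> dist t c < e3 \<Longrightarrow> dist (f t) (f c) < \<epsilon>"
    using f(1) \<epsilon>(1) unfolding continuous_on_iff by metis
  define e where "e = min e1 (min e2 e3)"
  have e: "e > 0" using e1 e2 e3 by (simp add: e_def)
  obtain d where d: "d > 0" "\<And>y. y \<in> {c-d<..<c} \<Longrightarrow> \<exists>z\<in>{c<..<c+e} \<inter> {0..1}. g z = g y"
    using e2(2)
  proof
    assume a: "\<forall>t\<in>{0..1}. t \<noteq> c \<and> \<bar>t - c\<bar> < e2 \<longrightarrow> g t < g c"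
    show ?thesis
      by (rule strict_max_matching[OF g(1) c01 e]) (use a that in \<open>auto simp: e_def\<close>)
  next
    assume a: "\<forall>t\<in>{0..1}. t \<noteq> c \<and> \<bar>t - c\<bar> < e2 \<longrightarrow> g c < g t"
    \<comment> \<open>A strict minimum of \<open>g\<close> is a strict maximum of its negative, with
      the same matched pairs.\<close>
    show ?thesis
      by (rule strict_max_matching[OF continuous_on_minus[OF g(1)] c01 e])
        (use a that in \<open>auto simp: e_def\<close>)
  qed
  show ?thesis
  proof
    show "0 < min (min d e) c" "min (min d e) c \<le> c" using d e c01 by auto
    show "\<forall>y\<in>{c - min (min d e) c<..<c}. \<exists>z\<in>{0..1}. z \<noteq> y \<and> g z = g y \<and> f z = f y"
    proof
      fix y assume y: "y \<in> {c - min (min d e) c<..<c}"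
      then have "y \<in> {c-d<..<c}" by auto
      then obtain z where z: "z \<in> {c<..<c+e}" "z \<in> {0..1}" "g z = g y" using d(2) by blast
      have y': "y \<in> {0..1}" "y \<noteq> c" "\<bar>y - c\<bar> < e" using y c01 by auto
      have z': "z \<noteq> c" "\<bar>z - c\<bar> < e" using z(1) by auto
      have I: "f y \<in> {0..1}" "f z \<in> {0..1}" using f(2) y'(1) z(2) by blast+
      have near: "\<bar>f y - f c\<bar> < \<epsilon>" "\<bar>f z - f c\<bar> < \<epsilon>"
        using e3(2)[of y] e3(2)[of z] y' z' z(2) by (auto simp: dist_real_def e_def)
      have eq: "g (f y) = g (f z)"
        using commutes_with_inverse_commute[OF comm g(2)] y'(1) z(2,3) by simp
      \<comment> \<open>The strict extremum of \<open>f\<close> at \<open>c\<close> puts both images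
        on one side of \<open>f c\<close>.\<close>
      from e1(2) have "f y < f c \<and> f z < f c \<or> f c < f y \<and> f c < f z"
        using y' z' z(2) by (auto simp: e_def)
      then have "f z = f y"
      proof
        assume "f y < f c \<and> f z < f c"
        then show ?thesis using I near by (intro inj_onD[OF \<epsilon>(2) eq[symmetric]]) auto
      next
        assume "f c < f y \<and> f c < f z"
        then show ?thesis using I near by (intro inj_onD[OF \<epsilon>(3) eq[symmetric]]) auto
      qed
      then show "\<exists>z\<in>{0..1}. z \<noteq> y \<and> g z = g y \<and> f z = f y"
        using z y by (intro bexI[of _ z]) auto
    qed
  qed
qed

theorem corollary4p15:
  fixes f g :: "real \<Rightarrow> real"
  assumes "continuous_on {0..1} f" and "f ` {0..1} = {0..1}" and "piecewise_monotone f"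
    and "continuous_on {0..1} g" and "g ` {0..1} = {0..1}" and "piecewise_monotone g"
    and "commutes_with_inverse f g"
  shows "critical_points f \<inter> critical_points g = {}"
proof (rule ccontr)
  assume "\<not> ?thesis"
  then obtain c where c: "c \<in> critical_points f" "c \<in> critical_points g" by auto
  let ?V = "singular_values g"
  obtain d where d: "0 < d" "d \<le> c"
    "\<forall>y\<in>{c-d<..<c}. \<exists>z\<in>{0..1}. z \<noteq> y \<and> g z = g y \<and> f z = f y"
    using common_critical_point_fold[OF assms c] .
  \<comment> \<open>\<open>B\<close> collects the points \<open>y\<close> for which
    \<open>g y\<close> or \<open>f (g y)\<close> is singular; it is finite because all fibres of
    \<open>f\<close> and \<open>g\<close> are.\<close>
  define B where "B = (\<Union>v\<in>?V. interval_fibre g v \<union> (\<Union>x\<in>interval_fibre f v. interval_fibre g x))"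
  have "finite B"
    unfolding B_def using assms finite_singular_values finite_interval_fibre
    by (intro finite_UN_I finite_UnI) auto
  then have "infinite ({c-d<..<c} - B)" using d(1) by (simp add: infinite_Ioo)
  then obtain y where y: "y \<in> {c-d<..<c}" "y \<notin> B"
    by (metis Diff_iff all_not_in_conv finite.emptyI)
  then obtain z where z: "z \<in> {0..1}" "z \<noteq> y" "g z = g y" "f z = f y" using d(3) by blast
  have y01: "y \<in> {0..1}" using y(1) d(2) c(1) by (auto simp: critical_points_def)
  then have gy: "g y \<in> {0..1}" using assms(5) by blast
  have "g y \<notin> ?V" "f (g y) \<notin> ?V"
    using y(2) y01 gy by (auto simp: B_def interval_fibre_def)
  then have "card (interval_fibre g (f (g y))) = card (interval_fibre g (g y))"
    using card_fibre_invariant[OF assms gy] by simp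
  moreover have "f ` interval_fibre g (g y) = interval_fibre g (f (g y))"
    using assms(7) gy by (auto simp: commutes_with_inverse_def)
  \<comment> \<open>A surjection between finite sets of equal size is injective, yet
    \<open>f\<close> identifies \<open>y\<close> and \<open>z\<close> in this fibre.\<close>
  ultimately have "inj_on f (interval_fibre g (g y))"
    using finite_interval_fibre[OF assms(4,6)] by (simp add: eq_card_imp_inj_on)
  moreover have "y \<in> interval_fibre g (g y)" "z \<in> interval_fibre g (g y)"
    using y01 z by (simp_all add: interval_fibre_def)
  ultimately show False using inj_onD z(2,4) by metis
qed

end
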